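(* Let $\mathcal{L}$ be the family of all lines in the plane $\mathbb{R}^2$ containing the origin. There exists a subgroup $G$ of the additive group $\mathbb{R}^2$ such that $G\cap L$ is an infinite discrete set for every $L\in\mathcal{L}$.
   Context: "Discrete" means discrete as a subspace of $\mathbb{R}^2$ with the Euclidean topology. *)

theory Defs
  imports "HOL-Analysis.Analysis" "HOL-Algebra.Group"
begin

definition plane_group :: "(real ^ 2) monoid"
  where "plane_group = \<lparr>carrier = UNIV, monoid.mult = (+), one = 0\<rparr>"

definition lines_through_origin :: "(real ^ 2) set set"
  where "lines_through_origin = {L. affine L \<and> aff_dim L = 1 \<and> 0 \<in> L}"

lemma comm_group_plane_group: "comm_group plane_group"
proof (rule comm_groupI)
  fix x assume "x \<in> carrier plane_group"
  show "\<exists>y\<in>carrier plane_group. y \<otimes>\<^bsub>plane_group\<^esub> x = \<one>\<^bsub>plane_group\<^esub>"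
    by (rule bexI[of _ "- x"]) (simp_all add: plane_group_def)
qed (simp_all add: plane_group_def algebra_simps)

lemma inv_plane_group: "inv\<^bsub>plane_group\<^esub> x = - x"
proof -
  interpret comm_group plane_group by (rule comm_group_plane_group)
  show ?thesis
    by (rule inv_equality) (simp_all add: plane_group_def)
qed

lemma subgroup_plane_group_iff:
  "subgroup G plane_group \<longleftrightarrow>
     0 \<in> G \<and> (\<forall>x\<in>G. \<forall>y\<in>G. x + y \<in> G) \<and> (\<forall>x\<in>G. - x \<in> G)"
  by (auto simp: subgroup_def inv_plane_group) (auto simp: plane_group_def)

lemma lines_through_origin_iff:
  "L \<in> lines_through_origin \<longleftrightarrow> (\<exists>v. v \<noteq> 0 \<and> L = span {v})"
proof
  assume "L \<in> lines_through_origin"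
  then have L: "subspace L" "dim L = 1"
    by (auto simp: lines_through_origin_def subspace_affine aff_dim_zero hull_inc)
  from basis_exists[of L] obtain B
    where B: "B \<subseteq> L" "independent B" "L \<subseteq> span B" "card B = dim L"
    by blast
  then obtain v where v: "B = {v}"
    using L(2) card_1_singletonE by metis
  with B have "v \<noteq> 0" by (auto simp: dependent_zero)
  moreover have "L = span {v}"
    using B v L(1) by (metis span_minimal subset_antisym)
  ultimately show "\<exists>v. v \<noteq> 0 \<and> L = span {v}" by blast
next
  assume "\<exists>v. v \<noteq> 0 \<and> L = span {v}"
  then obtain v where v: "v \<noteq> 0" "L = span {v}" by blast
  then show "L \<in> lines_through_origin"
    by (simp add: lines_through_origin_def subspace_imp_affine subspace_span
        span_zero aff_dim_zero hull_inc dim_eq_card_independent)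
qed

end

theory Submission
  imports Defs
begin

text \<open>
  Transfinite recursion along a well-order of the directions in which every proper initial segment
  has fewer than continuum many elements. Let \<open>H\<close> be the group generated by the vectors chosen so
  far. If the current line \<open>\<real> v\<close> meets \<open>H\<close> trivially, add a generator \<open>x = t v\<close>; all but fewer than
  continuum many \<open>t\<close> are such that \<open>g + n x\<close> and \<open>h + m x\<close> with \<open>g, h \<in> H\<close> are parallel only
  if \<open>m g = n h\<close>. Consequently a line that already meets the group nontrivially acquires no new
  points at later stages, and on a line that meets it for the first time every point \<open>h + m x\<close> is
  \<open>m / n\<close> times one fixed point \<open>g + n x\<close>; so the intersection lies in a cyclic group.
\<close>

section \<open>Integer spans: cardinality and well-ordered generators\<close>

unbundle cardinal_syntax

text \<open>Viewing the vector space as a module over the integers makes \<open>zmod.span S\<close>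
  the additive subgroup generated by \<open>S\<close>.\<close>

interpretation zmod: module "\<lambda>(n::int) x::'a::real_vector. real_of_int n *\<^sub>R x"
  by unfold_locales (auto simp: algebra_simps)

lemma card_of_int_ordLeq_infinite:
  assumes "infinite B"
  shows "|UNIV :: int set| \<le>o |B|"
proof -
  have "|UNIV :: int set| \<le>o |UNIV :: nat set|"
    using card_of_ordLeq[of "UNIV :: int set" "UNIV :: nat set"] inj_to_nat by blast
  then show ?thesis
    using assms infinite_iff_card_of_nat ordLeq_transitive by blast
qed

text \<open>The span is covered by countably many levels, each at most as large as \<open>B\<close>;
  one application of \<open>F\<close> adds an integer multiple of an element of \<open>S\<close>. A
  separate infinite bound \<open>B\<close> lets \<open>S\<close> be finite.\<close>

lemma card_of_zspan_ordLeq: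
  fixes S :: "'a::real_vector set" and B :: "'b set"
  assumes inf: "infinite B" and S: "|S| \<le>o |B|"
  shows "|zmod.span S| \<le>o |B|"
proof -
  define F where "F A = (\<lambda>(c::int, x, y). real_of_int c *\<^sub>R x + y) ` (UNIV \<times> S \<times> A)"
    for A :: "'a set"
  have nat_le: "|UNIV :: nat set| \<le>o |B|"
    using inf infinite_iff_card_of_nat by blast
  note int_le = card_of_int_ordLeq_infinite[OF inf]
  have level: "|(F ^^ n) {0}| \<le>o |B|" for n
  proof (induction n)
    case 0
    then show ?case
      using inf by (simp add: card_of_ordLeq_finite card_of_singl_ordLeq infinite_imp_nonempty)
  next
    case (Suc n)
    have "|(UNIV :: int set) \<times> S \<times> (F ^^ n) {0}| \<le>o |B|"
      using inf int_le S Suc by (intro card_of_Sigma_ordLeq_infinite ballI) auto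
    then show ?case
      unfolding funpow.simps o_apply F_def using card_of_image ordLeq_transitive by blast
  qed
  have "zmod.span S \<subseteq> (\<Union>n. (F ^^ n) {0})"
  proof
    fix x assume "x \<in> zmod.span S"
    then show "x \<in> (\<Union>n. (F ^^ n) {0})"
    proof (induction rule: zmod.span_induct_alt)
      case base
      have "0 \<in> (F ^^ 0) {0}" by simp
      then show ?case by blast
    next
      case (step c x y)
      then obtain n where "y \<in> (F ^^ n) {0}" by blast
      with step(1) have "real_of_int c *\<^sub>R x + y \<in> (F ^^ Suc n) {0}"
        unfolding funpow.simps o_apply F_def by force
      then show ?case by blast
    qed
  qed
  then have "|zmod.span S| \<le>o |\<Union>n. (F ^^ n) {0}|" by (rule card_of_mono1)
  also have "|\<Union>n. (F ^^ n) {0}| \<le>o |B|"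
    using inf nat_le level by (intro card_of_UNION_ordLeq_infinite ballI) auto
  finally show ?thesis .
qed

text \<open>Only finitely many generators occur in \<open>w\<close>, and the
  \<open>r\<close>-largest of their indices serves as \<open>a\<close>. The vector 0 is excluded
  because the empty combination supplies no index.\<close>

lemma zspan_initial_segment:
  assumes r: "Well_order r" "Field r = UNIV"
    and w: "w \<in> zmod.span (f ` A)" "w \<noteq> (0 :: 'a::real_vector)"
  shows "\<exists>a\<in>A. w \<in> zmod.span (f ` {b. (b, a) \<in> r})"
proof -
  have refl: "(a, a) \<in> r" and trans: "(a, b) \<in> r \<Longrightarrow> (b, c) \<in> r \<Longrightarrow> (a, c) \<in> r"
    and tot_neq: "a \<noteq> b \<Longrightarrow> (a, b) \<in> r \<or> (b, a) \<in> r" for a b c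
    using r by (auto simp: order_on_defs total_on_def refl_on_def dest: transD)
  have tot: "(a, b) \<in> r \<or> (b, a) \<in> r" for a b
    using refl tot_neq by (cases "a = b") auto
  have mono: "zmod.span (f ` {b. (b, a) \<in> r}) \<subseteq> zmod.span (f ` {b. (b, c) \<in> r})"
    if "(a, c) \<in> r" for a c
    using that by (intro zmod.span_mono image_mono) (auto intro: trans)
  have self: "f a \<in> zmod.span (f ` {b. (b, a) \<in> r})" for a
    using refl by (intro zmod.span_base) auto
  have "w = 0 \<or> (\<exists>a\<in>A. w \<in> zmod.span (f ` {b. (b, a) \<in> r}))"
    using w(1)
  proof (induction rule: zmod.span_induct_alt)
    case base
    then show ?case by simp
  next
    case (step c x y)
    from step(1) obtain d where d: "d \<in> A" "x = f d" by blast
    from step(2) show ?case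
    proof
      assume "y = 0"
      then show ?thesis using d self[of d] zmod.span_scale by force
    next
      assume "\<exists>a\<in>A. y \<in> zmod.span (f ` {b. (b, a) \<in> r})"
      then obtain a where a: "a \<in> A" "y \<in> zmod.span (f ` {b. (b, a) \<in> r})" by blast
      show ?thesis
        using tot[of a d]
      proof
        assume "(a, d) \<in> r"
        then show ?thesis
          using d a self[of d] mono by (blast intro: zmod.span_add zmod.span_scale)
      next
        assume "(d, a) \<in> r"
        then show ?thesis
          using d a self[of d] mono by (blast intro: zmod.span_add zmod.span_scale)
      qed
    qed
  qed
  with w(2) show ?thesis by blast
qed

section \<open>Parallel vectors and generic generators\<close>

definition cross :: "real ^ 2 \<Rightarrow> real ^ 2 \<Rightarrow> real"
  where "cross x y = x $ 1 * y $ 2 - x $ 2 * y $ 1"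

lemma cross_eq_0_in_span:
  assumes "cross x v = 0" "v \<noteq> 0"
  shows "x \<in> span {v}"
proof -
  have "v $ 1 \<noteq> 0 \<or> v $ 2 \<noteq> 0"
    using assms(2) by (auto simp: vec_eq_iff forall_2)
  then have "\<exists>k. x = k *\<^sub>R v"
  proof
    assume "v $ 1 \<noteq> 0"
    then have "x = (x $ 1 / v $ 1) *\<^sub>R v"
      using assms(1) by (simp add: vec_eq_iff forall_2 cross_def field_simps)
    then show ?thesis ..
  next
    assume "v $ 2 \<noteq> 0"
    then have "x = (x $ 2 / v $ 2) *\<^sub>R v"
      using assms(1) by (simp add: vec_eq_iff forall_2 cross_def field_simps)
    then show ?thesis ..
  qed
  then show ?thesis by (auto simp: span_singleton)
qed

lemma cross_span_singleton: "x \<in> span {v} \<Longrightarrow> y \<in> span {v} \<Longrightarrow> cross x y = 0"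
  by (auto simp: span_singleton cross_def)

text \<open>Zero coefficients matter: \<open>n = 0\<close> and \<open>m \<noteq> 0\<close> force
  \<open>g = 0\<close>, so no new point is parallel to a nonzero old one.\<close>

definition generic_over :: "(real ^ 2) set \<Rightarrow> real ^ 2 \<Rightarrow> bool"
  where "generic_over H x \<longleftrightarrow>
    (\<forall>g\<in>H. \<forall>h\<in>H. \<forall>n m :: int.
       cross (g + real_of_int n *\<^sub>R x) (h + real_of_int m *\<^sub>R x) = 0 \<longrightarrow>
       real_of_int m *\<^sub>R g = real_of_int n *\<^sub>R h)"

text \<open>The value \<open>x = 0\<close> records that the line through \<open>v\<close> already meets the group generated by \<open>S\<close>.\<close>

definition admissible :: "(real ^ 2) set \<Rightarrow> real ^ 2 \<Rightarrow> real ^ 2 \<Rightarrow> bool"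
  where "admissible S v x \<longleftrightarrow>
    (x = 0 \<or> generic_over (zmod.span S) x) \<and>
    (\<exists>w\<in>zmod.span (insert x S). w \<noteq> 0 \<and> w \<in> span {v})"

text \<open>For \<open>x = t v\<close> the determinant in \<open>generic_over\<close> is affine in
  \<open>t\<close>. A nonzero slope excludes a single \<open>t\<close> for each choice of
  \<open>g, h, n, m\<close>; a zero slope makes \<open>m g - n h\<close> parallel to
  \<open>v\<close>, hence 0 when the line misses the group.\<close>

lemma ex_admissible:
  fixes S :: "(real ^ 2) set"
  assumes S: "|S| <o |UNIV :: real set|" and v: "v \<noteq> 0"
  shows "\<exists>x. admissible S v x"
proof (cases "\<exists>w\<in>zmod.span S. w \<noteq> 0 \<and> w \<in> span {v}")
  case True
  then have "admissible S v 0"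
    by (auto simp: admissible_def zmod.span_insert)
  then show ?thesis ..
next
  case False
  \<comment> \<open>Adding the naturals makes \<open>?B\<close> infinite, even for finite
    \<open>S\<close>, while keeping it below the continuum.\<close>
  let ?H = "zmod.span S" and ?B = "S <+> (UNIV :: nat set)"
  define bad where "bad = (\<lambda>(g, h, n :: int, m :: int).
      - cross g h / (real_of_int m * cross g v - real_of_int n * cross h v)) `
      (?H \<times> ?H \<times> UNIV \<times> UNIV)"
  have inf: "infinite ?B" by (simp add: finite_Plus_iff)
  have "|S| \<le>o |?B|" by (rule card_of_Plus1)
  then have H: "|?H| \<le>o |?B|" by (rule card_of_zspan_ordLeq[OF inf])
  note int_le = card_of_int_ordLeq_infinite[OF inf]
  have "|UNIV :: nat set| <o |UNIV :: real set|"
  proof -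
    have "\<not> |UNIV :: real set| \<le>o |UNIV :: nat set|"
      using uncountable_UNIV_real card_of_ordLeq[of "UNIV :: real set" "UNIV :: nat set"]
      by (auto simp: countable_def)
    then show ?thesis by (simp add: not_ordLeq_iff_ordLess card_of_Well_order)
  qed
  then have B: "|?B| <o |UNIV :: real set|"
    using S by (intro card_of_Plus_ordLess_infinite) (auto simp: infinite_UNIV_char_0)
  have "|?H \<times> ?H \<times> (UNIV :: int set) \<times> (UNIV :: int set)| \<le>o |?B|"
    using inf H int_le by (intro card_of_Sigma_ordLeq_infinite ballI) auto
  then have "|bad| \<le>o |?B|"
    unfolding bad_def using card_of_image ordLeq_transitive by blast
  then have "|bad| <o |UNIV :: real set|"
    using B ordLeq_ordLess_trans by blast
  then obtain t where t: "t \<notin> bad"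
    by (metis UNIV_eq_I not_ordLess_ordLeq ordLeq_reflexive card_of_Well_order)
  \<comment> \<open>\<open>0\<close> is bad because it is the value of \<open>0 / 0\<close>.\<close>
  have "t \<noteq> 0"
  proof
    assume "t = 0"
    moreover have "(0, 0, 0, 0) \<in> ?H \<times> ?H \<times> (UNIV :: int set) \<times> (UNIV :: int set)"
      by (simp add: zmod.span_zero)
    ultimately have "t \<in> bad" unfolding bad_def by (force simp: cross_def)
    with t show False by blast
  qed
  have "real_of_int m *\<^sub>R g = real_of_int n *\<^sub>R h"
    if gh: "g \<in> ?H" "h \<in> ?H"
      and 0: "cross (g + real_of_int n *\<^sub>R t *\<^sub>R v) (h + real_of_int m *\<^sub>R t *\<^sub>R v) = 0"
    for g h and n m :: int
  proof -
    let ?d = "real_of_int m * cross g v - real_of_int n * cross h v"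
    have eq: "cross g h + t * ?d = 0"
      using 0 by (simp add: cross_def algebra_simps)
    have "?d = 0"
    proof (rule ccontr)
      assume "?d \<noteq> 0"
      with eq have "t = - cross g h / ?d" by (simp add: field_simps)
      with gh show False
        using t unfolding bad_def by (auto simp: image_iff)
    qed
    let ?u = "real_of_int m *\<^sub>R g - real_of_int n *\<^sub>R h"
    have "cross ?u v = 0" using \<open>?d = 0\<close> by (simp add: cross_def algebra_simps)
    then have "?u \<in> span {v}" using v by (rule cross_eq_0_in_span)
    moreover have "?u \<in> ?H" using gh by (intro zmod.span_diff zmod.span_scale)
    ultimately show ?thesis using False by auto
  qed
  then have "generic_over ?H (t *\<^sub>R v)" unfolding generic_over_def by blast
  moreover have "t *\<^sub>R v \<in> zmod.span (insert (t *\<^sub>R v) S)" by (simp add: zmod.span_base)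
  moreover have "t *\<^sub>R v \<noteq> 0" using \<open>t \<noteq> 0\<close> v by simp
  moreover have "t *\<^sub>R v \<in> span {v}" by (simp add: span_mul span_base)
  ultimately have "admissible S v (t *\<^sub>R v)"
    unfolding admissible_def by blast
  then show ?thesis ..
qed

section \<open>The transfinite choice of generators\<close>

text \<open>The cardinal order of the reals is used, so that fewer than continuum many generators
  precede each stage.\<close>

lemma ex_admissible_sequence:
  fixes v :: "real \<Rightarrow> real ^ 2"
  assumes "\<And>a. v a \<noteq> 0"
  obtains r f where "Well_order r" "Field r = (UNIV :: real set)"
    and "\<And>a. admissible (f ` underS r a) (v a) (f a)"
proof -
  let ?r = "|UNIV :: real set|"
  have r: "Well_order ?r" "Field ?r = UNIV" by (rule card_of_Well_order) (simp add: Field_card_of)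
  have "\<exists>f. \<forall>a. admissible (f ` underS ?r a) (v a) (f a)"
  proof (rule dependent_wf_choice[where R = "?r - Id"])
    show "wf (?r - Id)"
      using card_of_well_order_on unfolding well_order_on_def by blast
  next
    fix f g a x assume "\<And>z. (z, a) \<in> ?r - Id \<Longrightarrow> f z = (g z :: real ^ 2)"
    then have "f ` underS ?r a = g ` underS ?r a"
      by (intro image_cong) (auto simp: underS_def)
    then show "admissible (f ` underS ?r a) (v a) x = admissible (g ` underS ?r a) (v a) x"
      by simp
  next
    fix a and f :: "real \<Rightarrow> real ^ 2"
    have "|underS ?r a| <o ?r"
      by (rule card_of_underS[OF card_of_Card_order]) (simp add: Field_card_of)
    then have "|f ` underS ?r a| <o ?r"
      using card_of_image ordLeq_ordLess_trans by blast
    then show "\<exists>x. admissible (f ` underS ?r a) (v a) x"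
      using assms by (rule ex_admissible)
  qed
  then show thesis using r that by blast
qed

section \<open>Intersections of the group with lines\<close>

text \<open>Angles let the reals index all directions; repetitions do no harm.\<close>

lemma span_singleton_unit_vector:
  assumes "u \<noteq> (0 :: real ^ 2)"
  shows "\<exists>a. span {vector [cos a, sin a]} \<subseteq> span {u}"
proof -
  let ?w = "(1 / norm u) *\<^sub>R u"
  have "norm ?w = 1" using assms by simp
  then have "(?w $ 1)\<^sup>2 + (?w $ 2)\<^sup>2 = 1"
    by (simp only: norm_vec_def L2_set_def sum_2 real_norm_def power2_abs real_sqrt_eq_1_iff)
  then obtain a where "?w $ 1 = cos a" "?w $ 2 = sin a"
    using sincos_total_2pi by metis
  then have "vector [cos a, sin a] = ?w"
    by (simp add: vec_eq_iff forall_2)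
  then have "vector [cos a, sin a] \<in> span {u}"
    using span_mul[of u "{u}" "1 / norm u"] by (simp add: span_base)
  then have "span {vector [cos a, sin a]} \<subseteq> span {u}"
    by (intro span_minimal) (auto simp: subspace_span)
  then show ?thesis ..
qed

theorem theorem10:
  "\<exists>G. subgroup G plane_group \<and>
       (\<forall>L\<in>lines_through_origin. infinite (G \<inter> L) \<and> discrete (G \<inter> L))"
proof -
  define v where "v a = (vector [cos a, sin a] :: real ^ 2)" for a
  have "v a \<noteq> 0" for a
    using sin_zero_norm_cos_one[of a] by (auto simp: v_def vec_eq_iff forall_2)
  then obtain r f where r: "Well_order r" "Field r = (UNIV :: real set)"
    and adm: "\<And>a. admissible (f ` underS r a) (v a) (f a)"
    using ex_admissible_sequence by metis
  define G where "G = zmod.span (range f)"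
  \<comment> \<open>\<open>K a\<close> is the group just after stage \<open>a\<close>,
    \<open>K' a\<close> the group just before it.\<close>
  define K where "K a = zmod.span (f ` {b. (b, a) \<in> r})" for a
  define K' where "K' a = zmod.span (f ` underS r a)" for a
  have wf: "wf (r - Id)" using r by (simp add: well_order_on_def)
  have minimal: "\<exists>a. P a \<and> (\<forall>b. (b, a) \<in> r - Id \<longrightarrow> \<not> P b)" if "P c" for P c
    using wf that unfolding wf_eq_minimal by (metis mem_Collect_eq)
  have refl: "(a, a) \<in> r" and tot: "a \<noteq> b \<Longrightarrow> (a, b) \<in> r \<or> (b, a) \<in> r" for a b
    using r by (auto simp: order_on_defs total_on_def refl_on_def)
  have K_insert: "K a = zmod.span (insert (f a) (f ` underS r a))" for a
    unfolding K_def using refl by (intro arg_cong[where f = zmod.span]) (auto simp: underS_def)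
  have K_G: "K a \<subseteq> G" for a unfolding K_def G_def by (intro zmod.span_mono) auto
  have split: "\<exists>g n. g \<in> K' a \<and> w = g + real_of_int n *\<^sub>R f a" if "w \<in> K a" for w a
    using that unfolding K_insert K'_def zmod.span_insert by (auto simp: algebra_simps)
  have K_K': "K b \<subseteq> K' a" if "(b, a) \<in> r - Id" for a b
  proof -
    have "{c. (c, b) \<in> r} \<subseteq> underS r a"
      using that r unfolding underS_def order_on_defs
      by (auto dest: transD antisymD)
    then show ?thesis unfolding K_def K'_def by (intro zmod.span_mono image_mono)
  qed
  have K'_below: "\<exists>b. (b, a) \<in> r - Id \<and> w \<in> K b" if "w \<in> K' a" "w \<noteq> 0" for w a
    using zspan_initial_segment[OF r, of w f "underS r a"] that
    unfolding K_def K'_def underS_def by blast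
  have "subgroup G plane_group"
    unfolding subgroup_plane_group_iff G_def
    by (auto intro: zmod.span_zero zmod.span_add zmod.span_neg)
  moreover have "infinite (G \<inter> L) \<and> discrete (G \<inter> L)" if L: "L \<in> lines_through_origin" for L
  proof -
    obtain u where u: "u \<noteq> 0" "L = span {u}"
      using L unfolding lines_through_origin_iff by blast
    obtain c where c: "span {v c} \<subseteq> L"
      using span_singleton_unit_vector[OF u(1)] u(2) unfolding v_def by blast
    have "\<exists>w\<in>K c. w \<noteq> 0 \<and> w \<in> L"
      using adm[of c] c unfolding admissible_def K_insert by blast
    \<comment> \<open>Stage \<open>a\<close> is the first at which the group meets \<open>L\<close>
      nontrivially.\<close>
    then obtain a where a: "\<exists>w\<in>K a. w \<noteq> 0 \<and> w \<in> L"
      and a_min: "\<And>b. (b, a) \<in> r - Id \<Longrightarrow> \<not> (\<exists>w\<in>K b. w \<noteq> 0 \<and> w \<in> L)"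
      using minimal[of "\<lambda>a. \<exists>w\<in>K a. w \<noteq> 0 \<and> w \<in> L"] by blast
    then obtain w where w: "w \<in> K a" "w \<noteq> 0" "w \<in> L" by blast
    obtain g n where g: "g \<in> K' a" and w_eq: "w = g + real_of_int n *\<^sub>R f a"
      using split[OF w(1)] by blast
    have w_new: "w \<notin> K' a" using K'_below a_min w by blast
    then have n: "n \<noteq> 0" using g w_eq by auto
    have multiple: "\<exists>m :: int. z = (real_of_int m / real_of_int n) *\<^sub>R w"
      if z: "z \<in> G \<inter> L" for z
    proof (cases "z = 0")
      case True
      then show ?thesis by (intro exI[of _ 0]) simp
    next
      case False
      then obtain d where "z \<in> K d"
        using zspan_initial_segment[OF r, of z f UNIV] z unfolding K_def G_def by blast
      then obtain b where b: "z \<in> K b" and b_min: "\<And>e. (e, b) \<in> r - Id \<Longrightarrow> z \<notin> K e"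
        using minimal[of "\<lambda>b. z \<in> K b"] by blast
      obtain h m where h: "h \<in> K' b" and z_eq: "z = h + real_of_int m *\<^sub>R f b"
        using split[OF b] by blast
      \<comment> \<open>Since \<open>z\<close> first appears at stage \<open>b\<close>, the
        generator \<open>f b\<close> is nonzero, which rules out the alternative
        \<open>x = 0\<close> in \<open>admissible\<close>.\<close>
      have z_new: "z \<notin> K' b" using K'_below b_min False by blast
      then have m: "m \<noteq> 0" and fb: "f b \<noteq> 0" using h z_eq by auto
      have gen: "generic_over (K' b) (f b)"
        using adm[of b] fb unfolding admissible_def K'_def by blast
      have para: "cross w z = 0" using w z u(2) cross_span_singleton by blast
      \<comment> \<open>Were \<open>b\<close> later than \<open>a\<close>, then \<open>w\<close>
        would be an old point parallel to the new point \<open>z\<close>; genericity with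
        coefficient 0 at \<open>w\<close> gives \<open>m w = 0\<close>.\<close>
      have "b = a"
      proof (rule ccontr)
        assume "b \<noteq> a"
        moreover have "(b, a) \<notin> r - Id" using a_min b z False by blast
        ultimately have "(a, b) \<in> r - Id" using tot by blast
        then have "w \<in> K' b" using K_K' w by blast
        moreover have "cross (w + real_of_int 0 *\<^sub>R f b) (h + real_of_int m *\<^sub>R f b) = 0"
          using para z_eq by simp
        ultimately have "real_of_int m *\<^sub>R w = real_of_int 0 *\<^sub>R h"
          using gen h unfolding generic_over_def by blast
        with m w show False by simp
      qed
      \<comment> \<open>Both points now use the same generator; adding \<open>m n f a\<close> to
        both sides turns this relation into \<open>m w = n z\<close>.\<close>
      then have "real_of_int m *\<^sub>R g = real_of_int n *\<^sub>R h"
        using gen g h para unfolding generic_over_def w_eq z_eq by blast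
      then have "real_of_int m *\<^sub>R w = real_of_int n *\<^sub>R z"
        unfolding w_eq z_eq \<open>b = a\<close> by (simp add: scaleR_add_right mult.commute)
      then have "(1 / real_of_int n) *\<^sub>R (real_of_int m *\<^sub>R w) = z"
        using n by simp
      then have "z = (real_of_int m / real_of_int n) *\<^sub>R w" by simp
      then show ?thesis ..
    qed
    \<comment> \<open>All points are integer multiples of \<open>w / n\<close>, so distinct ones are
      at least \<open>norm w / \<bar>n\<bar>\<close> apart.\<close>
    have "uniform_discrete (G \<inter> L)"
    proof (rule uniformI2)
      show "0 < norm w / \<bar>real_of_int n\<bar>" using w n by simp
    next
      fix y z assume yz: "y \<in> G \<inter> L" "z \<in> G \<inter> L" "y \<noteq> z"
      obtain k where k: "y = (real_of_int k / real_of_int n) *\<^sub>R w"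
        using multiple yz by blast
      obtain l where l: "z = (real_of_int l / real_of_int n) *\<^sub>R w"
        using multiple yz by blast
      have "k \<noteq> l" using yz k l by auto
      then have "1 \<le> \<bar>real_of_int (k - l)\<bar>" by linarith
      have "y - z = (real_of_int (k - l) / real_of_int n) *\<^sub>R w"
        unfolding k l by (simp add: diff_divide_distrib scaleR_diff_left)
      then have "dist y z = \<bar>real_of_int (k - l)\<bar> * (norm w / \<bar>real_of_int n\<bar>)"
        by (simp add: dist_norm)
      also have "\<dots> \<ge> 1 * (norm w / \<bar>real_of_int n\<bar>)"
        by (rule mult_right_mono) (use \<open>1 \<le> _\<close> in auto)
      finally show "norm w / \<bar>real_of_int n\<bar> \<le> dist y z" by simp
    qed
    then have "discrete (G \<inter> L)" by (rule uniform_discrete_imp_discrete)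
    moreover have "infinite (G \<inter> L)"
    proof (rule infinite_super)
      show "range (\<lambda>k :: int. real_of_int k *\<^sub>R w) \<subseteq> G \<inter> L"
        using w K_G[of a] u(2) zmod.span_scale[of w "range f"]
        unfolding G_def by (auto simp: span_mul)
      have "inj (\<lambda>k :: int. real_of_int k *\<^sub>R w)" using w by (auto simp: inj_def)
      then show "infinite (range (\<lambda>k :: int. real_of_int k *\<^sub>R w))"
        by (simp add: finite_image_iff infinite_UNIV_int)
    qed
    ultimately show ?thesis by blast
  qed
  ultimately show ?thesis by blast
qed

end
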